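(* Let $G$ be a connected simple graph with $|E(G)|>\nu_2(G)$. Then $$\left\lceil \frac{\nu_2(G)}{2}\right\rceil\leq \beta(G)\leq \nu_2(G)-1.$$
   Context: All graphs are finite, undirected and simple. A vertex cover of $G$ is a set $T\subseteq V(G)$ such that every edge of $G$ has at least one end in $T$; the covering number $\beta(G)$ is the minimum cardinality of a vertex cover of $G$. For a set of edges $R\subseteq E(G)$, $G[R]$ denotes the subgraph of $G$ induced by $R$ (its edges are $R$, its vertices are the ends of edges of $R$). A 2-degree-packing of $G$ is a set $R\subseteq E(G)$ such that $\Delta(G[R])\leq 2$, where $\Delta$ denotes maximum degree; the 2-degree-packing number $\nu_2(G)$ is the maximum cardinality of a 2-degree-packing of $G$. *)

theory Defs
  imports Complex_Main
begin

text \<open>A graph is a pair of a vertex set and a set of edges, an edge being the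
  two-element set of its ends.\<close>

type_synonym 'a ugraph = "'a set \<times> 'a set set"

abbreviation verts :: "'a ugraph \<Rightarrow> 'a set" where "verts \<equiv> fst"
abbreviation edges :: "'a ugraph \<Rightarrow> 'a set set" where "edges \<equiv> snd"

definition simple_graph :: "'a ugraph \<Rightarrow> bool" where
  "simple_graph G \<longleftrightarrow> finite (verts G) \<and> (\<forall>e\<in>edges G. e \<subseteq> verts G \<and> card e = 2)"

definition adj_rel :: "'a ugraph \<Rightarrow> 'a rel" where
  "adj_rel G = {(u, v). {u, v} \<in> edges G}"

definition connected_graph :: "'a ugraph \<Rightarrow> bool" where
  "connected_graph G \<longleftrightarrow> (\<forall>u\<in>verts G. \<forall>v\<in>verts G. (u, v) \<in> (adj_rel G)\<^sup>*)"

definition degree :: "'a ugraph \<Rightarrow> 'a \<Rightarrow> nat" where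
  "degree G v = card {e \<in> edges G. v \<in> e}"

text \<open>Inserting 0 only matters for the graph without vertices, which arises as
  the subgraph induced by the empty set of edges.\<close>

definition max_degree :: "'a ugraph \<Rightarrow> nat" where
  "max_degree G = Max (insert 0 (degree G ` verts G))"

definition edge_induced :: "'a set set \<Rightarrow> 'a ugraph" where
  "edge_induced R = (\<Union>R, R)"

definition vertex_cover :: "'a ugraph \<Rightarrow> 'a set \<Rightarrow> bool" where
  "vertex_cover G T \<longleftrightarrow> T \<subseteq> verts G \<and> (\<forall>e\<in>edges G. e \<inter> T \<noteq> {})"

definition covering_number :: "'a ugraph \<Rightarrow> nat" where
  "covering_number G = Min (card ` {T. vertex_cover G T})"

definition two_degree_packing :: "'a ugraph \<Rightarrow> 'a set set \<Rightarrow> bool" where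
  "two_degree_packing G R \<longleftrightarrow> R \<subseteq> edges G \<and> max_degree (edge_induced R) \<le> 2"

definition two_degree_packing_number :: "'a ugraph \<Rightarrow> nat" where
  "two_degree_packing_number G = Max (card ` {R. two_degree_packing G R})"

end

theory Submission
  imports Defs
begin

text \<open>Lower bound: a vertex of a cover meets at most two edges of a packing.

Upper bound: the inner vertices \<open>I\<close> of a depth-first search tree cover all edges, since two leaves
are never adjacent. Selecting for each inner vertex the edge to one child gives vertex-disjoint
descending paths, hence a packing with \<open>card I\<close> edges. One more is gained as follows. If the root
has two children, select both edges. If its only child is an inner vertex and the root is adjacent
to a leaf, let the selected path from the root lead to that leaf and close it to a cycle. If all
neighbours of the root are inner vertices, drop the root from the cover. The remaining graphs have
at most one edge.\<close>

section \<open>Degrees in sets of edges\<close>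

abbreviation deg :: "'a set set \<Rightarrow> 'a \<Rightarrow> nat" where
  "deg M \<equiv> degree (edge_induced M)"

lemma deg_eq: "deg M v = card {e \<in> M. v \<in> e}"
  by (simp add: degree_def edge_induced_def)

lemma deg_Un: "deg (M \<union> N) v \<le> deg M v + deg N v"
proof -
  have "{e \<in> M \<union> N. v \<in> e} = {e \<in> M. v \<in> e} \<union> {e \<in> N. v \<in> e}" by auto
  then show ?thesis by (simp add: deg_eq card_Un_le)
qed

lemma deg_outside: "M \<subseteq> Pow S \<Longrightarrow> v \<notin> S \<Longrightarrow> deg M v = 0"
  unfolding deg_eq by (rule card_eq_0_iff[THEN iffD2]) blast

lemma deg_insert:
  assumes "finite M"
  shows "deg (insert e M) v \<le> deg M v + (if v \<in> e then 1 else 0)"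
proof -
  have "{x \<in> insert e M. v \<in> x} = (if v \<in> e then insert e {x \<in> M. v \<in> x} else {x \<in> M. v \<in> x})"
    by auto
  then show ?thesis using assms by (simp add: deg_eq card_insert_if)
qed

text \<open>\<open>max_degree\<close> sees only ends of edges of \<open>R\<close>. All other
  vertices have degree 0, so the bound can be stated for every \<open>v\<close>, without mention of
  the induced subgraph.\<close>

lemma max_degree_edge_induced_le_iff:
  assumes "finite (\<Union>R)"
  shows "max_degree (edge_induced R) \<le> k \<longleftrightarrow> (\<forall>v. deg R v \<le> k)"
proof -
  have "max_degree (edge_induced R) \<le> k \<longleftrightarrow> (\<forall>v\<in>\<Union>R. deg R v \<le> k)"
    using assms by (simp add: max_degree_def edge_induced_def)
  moreover have "deg R v = 0" if "v \<notin> \<Union>R" for v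
    using that by (intro deg_outside[of R "\<Union>R"]) auto
  ultimately show ?thesis by (metis le0)
qed

lemma Pow_disjoint:
  assumes "M \<subseteq> Pow A" "N \<subseteq> Pow (B - A)" "{} \<notin> M"
  shows "M \<inter> N = {}"
proof (rule equals0I)
  fix e assume "e \<in> M \<inter> N"
  then have "e \<subseteq> A \<inter> (B - A)" "e \<in> M" using assms by blast+
  then show False using assms(3) by simp
qed

section \<open>Depth-first search: branches, inner vertices and packings\<close>

text \<open>Connectedness of the subgraph induced on \<open>S\<close>: both ends of each step lie in
  \<open>S\<close>, so walks cannot leave it. The vertex \<open>r\<close> is singled out as root of
  the search tree.\<close>

definition reaches_all :: "'a set set \<Rightarrow> 'a set \<Rightarrow> 'a \<Rightarrow> bool" where
  "reaches_all E S r \<longleftrightarrow> r \<in> S \<and> (\<forall>v\<in>S. (r, v) \<in> {(u, v). u \<in> S \<and> v \<in> S \<and> {u, v} \<in> E}\<^sup>*)"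

lemma reaches_all_neighbour:
  assumes "reaches_all E S r" "S \<noteq> {r}"
  obtains c where "c \<in> S" "c \<noteq> r" "{r, c} \<in> E"
proof -
  let ?A = "{(u, v). u \<in> S \<and> v \<in> S \<and> {u, v} \<in> E}"
  obtain v where v: "v \<in> S" "v \<noteq> r" using assms by (auto simp: reaches_all_def)
  then have "(r, v) \<in> ?A\<^sup>*" using assms by (auto simp: reaches_all_def)
  \<comment> \<open>The claim becomes true with the first step that leaves \<open>r\<close> and
    persists along the rest of the walk.\<close>
  then have "v \<noteq> r \<longrightarrow> (\<exists>c\<in>S. c \<noteq> r \<and> {r, c} \<in> E)"
    by (induction rule: rtrancl_induct) auto
  then show thesis using v that by blast
qed

text \<open>\<open>C\<close> is the component of \<open>c\<close> after deletion of
  \<open>r\<close>, that is, what a search explores from \<open>c\<close> before it returns to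
  \<open>r\<close>. An edge leaving \<open>C\<close> inside \<open>S\<close> must therefore end in
  \<open>r\<close>; this is why leaves of different branches are never adjacent.\<close>

lemma split_off_branch:
  assumes E: "\<forall>e\<in>E. card e = 2" and r: "reaches_all E S r"
    and c: "c \<in> S" "c \<noteq> r"
  obtains C where "c \<in> C" "r \<notin> C" "C \<subseteq> S" "reaches_all E C c" "reaches_all E (S - C) r"
    "\<forall>e\<in>E. e \<subseteq> S \<longrightarrow> e \<subseteq> C \<or> e \<subseteq> S - C \<or> r \<in> e"
proof -
  let ?A = "\<lambda>S. {(u, v). u \<in> S \<and> v \<in> S \<and> {u, v} \<in> E}"
  define C where "C = {v. (c, v) \<in> (?A (S - {r}))\<^sup>*}"
  have cC: "c \<in> C" by (simp add: C_def)
  have sub: "v \<in> S - {r}" if "v \<in> C" for v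
    using that unfolding C_def mem_Collect_eq
    by (induction rule: rtrancl_induct) (use c in auto)
  have C_step: "w \<in> C" if "v \<in> C" "w \<in> S - {r}" "{v, w} \<in> E" for v w
    using that sub[OF that(1)] unfolding C_def
    by (auto intro: rtrancl.rtrancl_into_rtrancl)
  have "(c, v) \<in> (?A C)\<^sup>*" if "v \<in> C" for v
  proof -
    have "(c, v) \<in> (?A (S - {r}))\<^sup>*" using that by (simp add: C_def)
    then have "v \<in> C \<and> (c, v) \<in> (?A C)\<^sup>*"
    proof (induction rule: rtrancl_induct)
      case (step y z)
      then have "z \<in> C" using C_step by blast
      then show ?case using step by (auto intro: rtrancl.rtrancl_into_rtrancl)
    qed (use cC in auto)
    then show ?thesis ..
  qed
  then have conC: "reaches_all E C c" using cC by (simp add: reaches_all_def)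
  have "(r, v) \<in> (?A (S - C))\<^sup>*" if "v \<in> S - C" for v
  proof -
    have "(r, v) \<in> (?A S)\<^sup>*" using that r by (auto simp: reaches_all_def)
    \<comment> \<open>A walk can leave \<open>C\<close> only into \<open>r\<close>, and at
      \<open>r\<close> it may be replaced by the empty walk. So the excursions into \<open>C\<close>
      can be cut out.\<close>
    then have "v \<in> C \<or> (r, v) \<in> (?A (S - C))\<^sup>*"
    proof (induction rule: rtrancl_induct)
      case (step y z)
      show ?case
      proof (cases "z \<in> C \<or> z = r")
        case False
        then have "y \<notin> C"
          using step.hyps C_step by blast
        then show ?thesis using step False by (auto intro: rtrancl.rtrancl_into_rtrancl)
      qed auto
    qed auto
    then show ?thesis using that by auto
  qed
  moreover have "r \<in> S - C" using r sub by (auto simp: reaches_all_def)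
  ultimately have conD: "reaches_all E (S - C) r" by (simp add: reaches_all_def)
  have "e \<subseteq> C \<or> e \<subseteq> S - C \<or> r \<in> e" if e: "e \<in> E" "e \<subseteq> S" for e
  proof -
    obtain x y where xy: "e = {x, y}" using E e by (auto simp: card_2_iff)
    have "{y, x} = {x, y}" by auto
    then show ?thesis using C_step[of x y] C_step[of y x] e xy by auto
  qed
  then show thesis using that[OF cC _ _ conC conD] sub by blast
qed

text \<open>\<open>I\<close> plays the role of the inner vertices of a depth-first search tree of \<open>S\<close> rooted at \<open>r\<close>.
  In the packing \<open>M\<close> the selected path from \<open>r\<close> may lead to any prescribed leaf \<open>l\<close>; all that is
  recorded of this is that \<open>r\<close> and \<open>l\<close> can both take a further edge.\<close>

definition dfs_cover :: "'a set set \<Rightarrow> 'a set \<Rightarrow> 'a \<Rightarrow> 'a set \<Rightarrow> bool" where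
  "dfs_cover E S r I \<longleftrightarrow> I \<subseteq> S \<and> (S \<noteq> {r} \<longrightarrow> r \<in> I) \<and> (\<forall>e\<in>E. e \<subseteq> S \<longrightarrow> e \<inter> I \<noteq> {}) \<and>
    (\<forall>l. \<exists>M\<subseteq>E. M \<subseteq> Pow S \<and> card M = card I \<and> (\<forall>v. deg M v \<le> 2) \<and> deg M r \<le> 1 \<and>
      (l \<notin> I \<longrightarrow> deg M l \<le> 1))"

lemma dfs_coverD:
  assumes "dfs_cover E S r I"
  shows "I \<subseteq> S" "S \<noteq> {r} \<Longrightarrow> r \<in> I" "e \<in> E \<Longrightarrow> e \<subseteq> S \<Longrightarrow> e \<inter> I \<noteq> {}"
  using assms by (auto simp: dfs_cover_def)

lemma dfs_cover_packing:
  assumes "dfs_cover E S r I"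
  obtains M where "M \<subseteq> E" "M \<subseteq> Pow S" "card M = card I" "\<And>v. deg M v \<le> 2" "deg M r \<le> 1"
    "l \<notin> I \<Longrightarrow> deg M l \<le> 1"
  using assms unfolding dfs_cover_def by metis

text \<open>Induction on the size of \<open>S\<close>: a branch \<open>C\<close> at a neighbour
  \<open>c\<close> of \<open>r\<close> is split off, and both \<open>C\<close> with root
  \<open>c\<close> and \<open>S - C\<close> with root \<open>r\<close> are smaller. The same
  \<open>l\<close> is prescribed in both parts; in the part that does not contain it, its degree is
  0.\<close>

lemma dfs_cover_exists:
  assumes E: "\<forall>e\<in>E. card e = 2" and "finite S" "reaches_all E S r"
  shows "\<exists>I. dfs_cover E S r I"
  using assms(2,3)
proof (induction "card S" arbitrary: S r rule: less_induct)
  case less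
  have rS: "r \<in> S" using less.prems by (simp add: reaches_all_def)
  show ?case
  proof (cases "S = {r}")
    case True
    have "\<not> e \<subseteq> {r}" if "e \<in> E" for e
      using E that card_mono[of "{r}" e] by fastforce
    then have "dfs_cover E S r {}"
      using True by (auto simp: dfs_cover_def deg_eq intro!: exI[of _ "{}"])
    then show ?thesis ..
  next
    case False
    obtain c where c: "c \<in> S" "c \<noteq> r" "{r, c} \<in> E"
      using reaches_all_neighbour[OF less.prems(2) False] by blast
    obtain C where C: "c \<in> C" "r \<notin> C" "C \<subseteq> S" "reaches_all E C c" "reaches_all E (S - C) r"
      "\<forall>e\<in>E. e \<subseteq> S \<longrightarrow> e \<subseteq> C \<or> e \<subseteq> S - C \<or> r \<in> e"
      using split_off_branch[OF E less.prems(2) c(1,2)] by blast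
    have fin: "finite C" "finite (S - C)" using less.prems C finite_subset by auto
    have "card C < card S" using C rS less.prems by (intro psubset_card_mono) auto
    then obtain I where I: "dfs_cover E C c I" using less.hyps[OF _ fin(1) C(4)] by blast
    have "card (S - C) < card S" using C less.prems by (intro psubset_card_mono) auto
    then obtain J where J: "dfs_cover E (S - C) r J" using less.hyps[OF _ fin(2) C(5)] by blast
    note IC = dfs_coverD(1)[OF I] and JC = dfs_coverD(1)[OF J]
    have fIJ: "finite I" "finite J" using IC JC fin by (auto intro: finite_subset)
    have cover: "e \<inter> (insert r (I \<union> J)) \<noteq> {}" if "e \<in> E" "e \<subseteq> S" for e
      using that C(6) dfs_coverD(3)[OF I, of e] dfs_coverD(3)[OF J, of e] by blast
    show ?thesis
    \<comment> \<open>If only \<open>r\<close> remains beside \<open>C\<close>, then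
      \<open>r\<close> joins the cover and the edge \<open>{r, c}\<close> pays for it. Otherwise
      \<open>r\<close> already lies in \<open>J\<close>, where an edge of its packing is counted for
      it, and no edge between \<open>r\<close> and \<open>C\<close> is added.\<close>
    proof (cases "S - C = {r}")
      case True
      have "\<exists>M\<subseteq>E. M \<subseteq> Pow S \<and> card M = card (insert r I) \<and> (\<forall>v. deg M v \<le> 2) \<and> deg M r \<le> 1 \<and>
          (l \<notin> insert r I \<longrightarrow> deg M l \<le> 1)" for l
      proof -
        obtain M where M: "M \<subseteq> E" "M \<subseteq> Pow C" "card M = card I" "\<And>v. deg M v \<le> 2"
          "deg M c \<le> 1" "l \<notin> I \<Longrightarrow> deg M l \<le> 1"
          by (rule dfs_cover_packing[OF I, of l]) blast
        have fM: "finite M" using M(2) fin(1) by (meson finite_Pow_iff finite_subset)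
        have r0: "deg M r = 0" using deg_outside[OF M(2)] C by auto
        \<comment> \<open>Needed for \<open>l = c\<close>: a leaf \<open>c\<close> receives the new
          edge \<open>{r, c}\<close>, so it must have had no edge before.\<close>
        have c0: "deg M c = 0" if "c \<notin> I"
        proof -
          have "C = {c}" using dfs_coverD(2)[OF I] that by blast
          then have "I = {}" using IC that by auto
          then show ?thesis using M(3) fM by (simp add: deg_eq)
        qed
        have "{r, c} \<notin> M" using M(2) C by auto
        then have "card (insert {r, c} M) = card (insert r I)"
          using fM fIJ IC C M(3) by (subst (1 2) card_insert_disjoint) auto
        moreover have d: "deg (insert {r, c} M) v \<le> deg M v + (if v \<in> {r, c} then 1 else 0)" for v
          by (rule deg_insert[OF fM])
        have "deg (insert {r, c} M) v \<le> 2" for v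
          using d[of v] r0 M(4)[of v] M(5) by (auto split: if_splits)
        moreover have "deg (insert {r, c} M) r \<le> 1" using d[of r] r0 by auto
        moreover have "l \<notin> insert r I \<longrightarrow> deg (insert {r, c} M) l \<le> 1"
          using d[of l] c0 M(6) by (auto split: if_splits)
        moreover have "insert {r, c} M \<subseteq> E" "insert {r, c} M \<subseteq> Pow S"
          using M(1,2) C(3) c rS by blast+
        ultimately show ?thesis by blast
      qed
      moreover have "e \<inter> insert r I \<noteq> {}" if "e \<in> E" "e \<subseteq> S" for e
        using cover[OF that] JC True by auto
      ultimately have "dfs_cover E S r (insert r I)"
        using IC C rS by (auto simp: dfs_cover_def)
      then show ?thesis ..
    next
      case False
      then have rJ: "r \<in> J" using dfs_coverD(2)[OF J] by blast
      have "\<exists>M\<subseteq>E. M \<subseteq> Pow S \<and> card M = card (I \<union> J) \<and> (\<forall>v. deg M v \<le> 2) \<and> deg M r \<le> 1 \<and>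
          (l \<notin> I \<union> J \<longrightarrow> deg M l \<le> 1)" for l
      proof -
        obtain M where M: "M \<subseteq> E" "M \<subseteq> Pow C" "card M = card I" "\<And>v. deg M v \<le> 2"
          "deg M c \<le> 1" "l \<notin> I \<Longrightarrow> deg M l \<le> 1"
          by (rule dfs_cover_packing[OF I, of l]) blast
        obtain N where N: "N \<subseteq> E" "N \<subseteq> Pow (S - C)" "card N = card J" "\<And>v. deg N v \<le> 2"
          "deg N r \<le> 1" "l \<notin> J \<Longrightarrow> deg N l \<le> 1"
          by (rule dfs_cover_packing[OF J, of l]) blast
        have fMN: "finite M" "finite N"
          using M(2) N(2) fin by (meson finite_Pow_iff finite_subset)+
        have "{} \<notin> E" using E by fastforce
        then have "M \<inter> N = {}" using M(1,2) N(2) by (intro Pow_disjoint) auto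
        then have "card (M \<union> N) = card (I \<union> J)"
          using IC JC M(3) N(3) fMN fIJ by (subst (1 2) card_Un_disjoint) auto
        moreover have d: "deg (M \<union> N) v \<le> (if v \<in> C then deg M v else deg N v)" for v
          using deg_Un[of M N v] deg_outside[OF M(2), of v] deg_outside[OF N(2), of v] by auto
        have "deg (M \<union> N) v \<le> 2" for v
          using d[of v] M(4)[of v] N(4)[of v] by (auto split: if_splits)
        moreover have "deg (M \<union> N) r \<le> 1" using d[of r] C(2) N(5) by auto
        moreover have "l \<notin> I \<union> J \<longrightarrow> deg (M \<union> N) l \<le> 1"
          using d[of l] M(6) N(6) by (auto split: if_splits)
        moreover have "M \<union> N \<subseteq> E" "M \<union> N \<subseteq> Pow S"
          using M(1,2) N(1,2) C(3) by blast+
        ultimately show ?thesis by blast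
      qed
      moreover have "e \<inter> (I \<union> J) \<noteq> {}" if "e \<in> E" "e \<subseteq> S" for e
        using cover[OF that] rJ by (simp add: insert_absorb)
      ultimately have "dfs_cover E S r (I \<union> J)"
        using IC JC C rJ by (auto simp: dfs_cover_def)
      then show ?thesis ..
    qed
  qed
qed

section \<open>The upper bound: one surplus edge at the root\<close>

text \<open>A search tree yields a cover and a packing of equal size, so the surplus has to be found
  at \<open>r\<close>. For a single edge both optimal sizes are 1, which \<open>two\<close>
  excludes.\<close>

lemma cover_less_packing:
  assumes E: "\<forall>e\<in>E. card e = 2 \<and> e \<subseteq> V" and V: "finite V" "reaches_all E V r"
    and two: "card E \<ge> 2"
  obtains T M where "T \<subseteq> V" "\<forall>e\<in>E. e \<inter> T \<noteq> {}" "M \<subseteq> E" "\<And>v. deg M v \<le> 2" "card T < card M"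
proof -
  have E2: "\<forall>e\<in>E. card e = 2" using E by blast
  have rV: "r \<in> V" using V by (simp add: reaches_all_def)
  have "V \<noteq> {r}"
  proof
    assume "V = {r}"
    then have "\<not> e \<subseteq> V" if "e \<in> E" for e
      using E2 that card_mono[of "{r}" e] by fastforce
    then have "E = {}" using E by blast
    then show False using two by simp
  qed
  then obtain c where c: "c \<in> V" "c \<noteq> r" "{r, c} \<in> E"
    using reaches_all_neighbour[OF V(2)] by blast
  obtain C where C: "c \<in> C" "r \<notin> C" "C \<subseteq> V" "reaches_all E C c" "reaches_all E (V - C) r"
    "\<forall>e\<in>E. e \<subseteq> V \<longrightarrow> e \<subseteq> C \<or> e \<subseteq> V - C \<or> r \<in> e"
    using split_off_branch[OF E2 V(2) c(1,2)] by blast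
  have fin: "finite C" "finite (V - C)" using V C finite_subset by auto
  obtain I where I: "dfs_cover E C c I" using dfs_cover_exists[OF E2 fin(1) C(4)] by blast
  obtain J where J: "dfs_cover E (V - C) r J" using dfs_cover_exists[OF E2 fin(2) C(5)] by blast
  note IC = dfs_coverD(1)[OF I] and JC = dfs_coverD(1)[OF J]
  have fIJ: "finite I" "finite J" using IC JC fin by (auto intro: finite_subset)
  have cover: "e \<inter> (insert r (I \<union> J)) \<noteq> {}" if "e \<in> E" for e
    using that E C(6) dfs_coverD(3)[OF I, of e] dfs_coverD(3)[OF J, of e] by blast
  show thesis
  proof (cases "V - C = {r}")
    case False
    then have rJ: "r \<in> J" using dfs_coverD(2)[OF J] by blast
    obtain M where M: "M \<subseteq> E" "M \<subseteq> Pow C" "card M = card I" "\<And>v. deg M v \<le> 2" "deg M c \<le> 1"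
      by (rule dfs_cover_packing[OF I, of r]) blast
    obtain N where N: "N \<subseteq> E" "N \<subseteq> Pow (V - C)" "card N = card J" "\<And>v. deg N v \<le> 2" "deg N r \<le> 1"
      by (rule dfs_cover_packing[OF J, of r]) blast
    have fMN: "finite M" "finite N"
      using M(2) N(2) fin by (meson finite_Pow_iff finite_subset)+
    have "{} \<notin> E" using E by fastforce
    then have "M \<inter> N = {}" using M(1,2) N(2) by (intro Pow_disjoint) auto
    then have "card (M \<union> N) = card (I \<union> J)"
      using IC JC M(3) N(3) fMN fIJ by (subst (1 2) card_Un_disjoint) auto
    \<comment> \<open>The surplus edge joins the two sides. Its ends are the roots of the two parts,
      each of degree at most 1 so far.\<close>
    moreover have "{r, c} \<notin> M \<union> N" using M(2) N(2) C by auto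
    ultimately have "card (I \<union> J) < card (insert {r, c} (M \<union> N))" using fMN by simp
    moreover have "deg (insert {r, c} (M \<union> N)) v \<le> 2" for v
      using deg_Un[of M N v] deg_outside[OF M(2), of v] deg_outside[OF N(2), of v] C(1,2)
        deg_insert[of "M \<union> N" "{r, c}" v] fMN M(4)[of v] M(5) N(4)[of v] N(5)
      by (cases "v \<in> C"; cases "v = r"; cases "v = c") auto
    moreover have "\<forall>e\<in>E. e \<inter> (I \<union> J) \<noteq> {}" using cover rJ by (simp add: insert_absorb)
    moreover have "I \<union> J \<subseteq> V" "insert {r, c} (M \<union> N) \<subseteq> E" using IC JC C M N c by auto
    ultimately show thesis using that by blast
  next
    case True
    have coverI: "e \<inter> insert r I \<noteq> {}" if "e \<in> E" for e
      using cover[OF that] JC True by auto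
    \<comment> \<open>If \<open>c\<close> were a leaf, \<open>{r, c}\<close> would be the only edge
      of the graph.\<close>
    have cI: "c \<in> I"
    proof (rule ccontr)
      assume "c \<notin> I"
      then have "C = {c}" using dfs_coverD(2)[OF I] by blast
      then have V2: "V = {r, c}" using True C by blast
      have "e = {r, c}" if "e \<in> E" for e
        using E that V2 c by (intro card_subset_eq) auto
      then have "card E \<le> card {{r, c}}" by (intro card_mono) auto
      then show False using two by simp
    qed
    show thesis
    proof (cases "\<exists>l. l \<notin> I \<and> {r, l} \<in> E")
      case False
      obtain M where M: "M \<subseteq> E" "M \<subseteq> Pow C" "card M = card I" "\<And>v. deg M v \<le> 2" "deg M c \<le> 1"
        by (rule dfs_cover_packing[OF I, of r]) blast
      have fM: "finite M" using M(2) fin(1) by (meson finite_Pow_iff finite_subset)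
      have r0: "deg M r = 0" using deg_outside[OF M(2)] C by auto
      have "{r, c} \<notin> M" using M(2) C by auto
      \<comment> \<open>All neighbours of \<open>r\<close> lie in \<open>I\<close>, so
        \<open>r\<close> stays out of the cover, while \<open>{r, c}\<close> still enlarges the
        packing.\<close>
      then have "card I < card (insert {r, c} M)" using fM M(3) by simp
      moreover have "deg (insert {r, c} M) v \<le> 2" for v
        using deg_insert[OF fM, of "{r, c}" v] r0 M(4)[of v] M(5) by (auto split: if_splits)
      moreover have "\<forall>e\<in>E. e \<inter> I \<noteq> {}"
      proof
        fix e assume e: "e \<in> E"
        show "e \<inter> I \<noteq> {}"
        proof (cases "r \<in> e")
          case True
          obtain x y where "e = {x, y}" using E e by (auto simp: card_2_iff)
          with True obtain z where "e = {r, z}" by fastforce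
          then show ?thesis using False e by auto
        qed (use coverI[OF e] in auto)
      qed
      moreover have "I \<subseteq> V" "insert {r, c} M \<subseteq> E" using IC C M c by auto
      ultimately show thesis using that by blast
    next
      case True
      then obtain l where l: "l \<notin> I" "{r, l} \<in> E" by blast
      have lr: "l \<noteq> r" "l \<noteq> c" using l E cI by fastforce+
      obtain M where M: "M \<subseteq> E" "M \<subseteq> Pow C" "card M = card I" "\<And>v. deg M v \<le> 2" "deg M c \<le> 1"
        "l \<notin> I \<Longrightarrow> deg M l \<le> 1"
        by (rule dfs_cover_packing[OF I, of l]) blast
      have fM: "finite M" using M(2) fin(1) by (meson finite_Pow_iff finite_subset)
      have r0: "deg M r = 0" using deg_outside[OF M(2)] C by auto
      \<comment> \<open>One new edge pays for \<open>r\<close>, the other is the surplus. The vertex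
        \<open>r\<close> rises from degree 0 to at most 2; \<open>c\<close> as root and
        \<open>l\<close> as prescribed leaf have degree at most 1 in \<open>M\<close>.\<close>
      let ?M = "insert {r, l} (insert {r, c} M)"
      have "{r, c} \<notin> M" "{r, l} \<notin> insert {r, c} M" using M(2) C lr by (auto simp: doubleton_eq_iff)
      then have "card (insert r I) < card ?M" using fM M(3) fIJ IC C by (auto simp: card_insert_if)
      moreover have "deg ?M v \<le> 2" for v
        using deg_insert[OF fM, of "{r, c}" v] deg_insert[of "insert {r, c} M" "{r, l}" v] fM
          r0 M(4)[of v] M(5) M(6)[OF l(1)] lr
        by (auto split: if_splits)
      moreover have "\<forall>e\<in>E. e \<inter> insert r I \<noteq> {}" using coverI by blast
      moreover have "insert r I \<subseteq> V" "?M \<subseteq> E" using IC C M c l rV by auto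
      ultimately show thesis using that by blast
    qed
  qed
qed

section \<open>The lower bound and the conclusion\<close>

text \<open>The stars of \<open>R\<close> at the vertices of \<open>T\<close> exhaust
  \<open>R\<close>, and each has at most two edges; overlaps only help.\<close>

lemma card_packing_le_double_cover:
  assumes "finite T" "\<forall>e\<in>R. e \<inter> T \<noteq> {}" "\<forall>v. deg R v \<le> 2"
  shows "card R \<le> 2 * card T"
proof -
  have "R = (\<Union>v\<in>T. {e \<in> R. v \<in> e})" using assms(2) by auto
  then have "card R \<le> (\<Sum>v\<in>T. card {e \<in> R. v \<in> e})"
    using card_UN_le[OF assms(1), of "\<lambda>v. {e \<in> R. v \<in> e}"] by simp
  also have "\<dots> \<le> (\<Sum>v\<in>T. 2)" using assms(3) by (intro sum_mono) (simp add: deg_eq)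
  finally show ?thesis by simp
qed

theorem theorem1p1:
  fixes G :: "'a ugraph"
  assumes "simple_graph G"
    and "connected_graph G"
    and "card (edges G) > two_degree_packing_number G"
  shows "\<lceil>real (two_degree_packing_number G) / 2\<rceil> \<le> int (covering_number G) \<and>
         int (covering_number G) \<le> int (two_degree_packing_number G) - 1"
proof -
  let ?V = "verts G" and ?E = "edges G"
  have V: "finite ?V" and E: "\<forall>e\<in>?E. card e = 2 \<and> e \<subseteq> ?V"
    using assms(1) by (auto simp: simple_graph_def)
  have fE: "finite ?E" using E V by (meson PowI finite_Pow_iff finite_subset subsetI)
  have pack: "two_degree_packing G R \<longleftrightarrow> R \<subseteq> ?E \<and> (\<forall>v. deg R v \<le> 2)" for R
  proof -
    have "finite (\<Union>R)" if "R \<subseteq> ?E"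
      using that E V by (intro finite_subset[of "\<Union>R" ?V]) auto
    then show ?thesis using max_degree_edge_induced_le_iff by (auto simp: two_degree_packing_def)
  qed
  \<comment> \<open>\<open>Max\<close> and \<open>Min\<close> need finite nonempty sets. Finiteness
    is shown here; the witnesses \<open>T\<close> and \<open>M\<close> give nonemptiness
    later.\<close>
  have fP: "finite {R. two_degree_packing G R}"
    by (rule finite_subset[of _ "Pow ?E"]) (use fE pack in auto)
  have fT: "finite {T. vertex_cover G T}"
    by (rule finite_subset[of _ "Pow ?V"]) (use V in \<open>auto simp: vertex_cover_def\<close>)
  have nu: "card R \<le> two_degree_packing_number G" if "two_degree_packing G R" for R
    using that fP by (simp add: two_degree_packing_number_def)
  \<comment> \<open>The strict inequality enters here: with at most one edge, the whole edge set
    would be a packing.\<close>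
  have two: "card ?E \<ge> 2"
  proof (rule ccontr)
    assume "\<not> card ?E \<ge> 2"
    moreover have "deg ?E v \<le> card ?E" for v using fE by (simp add: deg_eq card_mono)
    ultimately have "two_degree_packing G ?E"
      unfolding pack by (meson le_trans nat_le_linear order_refl)
    then show False using nu assms(3) by fastforce
  qed
  then obtain e where "e \<in> ?E" by fastforce
  then obtain r where r: "r \<in> ?V" using E by fastforce
  \<comment> \<open>Edges have their ends in \<open>verts G\<close>, so restricting the steps to
    this set changes nothing and \<open>connected_graph\<close> gives
    \<open>reaches_all\<close>.\<close>
  have "adj_rel G = {(u, v). u \<in> ?V \<and> v \<in> ?V \<and> {u, v} \<in> ?E}"
    using E by (auto simp: adj_rel_def)
  then have "reaches_all ?E ?V r"
    using assms(2) r by (simp add: reaches_all_def connected_graph_def)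
  from cover_less_packing[OF E V this two]
  obtain T M where TM: "T \<subseteq> ?V" "\<forall>e\<in>?E. e \<inter> T \<noteq> {}" "M \<subseteq> ?E" "\<And>v. deg M v \<le> 2"
    "card T < card M" by blast
  have T: "vertex_cover G T" using TM by (simp add: vertex_cover_def)
  then have "covering_number G \<le> card T" using fT by (simp add: covering_number_def)
  moreover have "card M \<le> two_degree_packing_number G" using TM nu pack by blast
  ultimately have upper: "covering_number G < two_degree_packing_number G" using TM(5) by linarith
  have "covering_number G \<in> card ` {T. vertex_cover G T}"
    unfolding covering_number_def using fT T by (intro Min_in) auto
  then obtain T' where T': "vertex_cover G T'" "covering_number G = card T'" by auto
  have "two_degree_packing_number G \<in> card ` {R. two_degree_packing G R}"
    unfolding two_degree_packing_number_def using fP TM(3,4) pack[of M] by (intro Max_in finite_imageI) auto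
  then obtain R where R: "two_degree_packing G R" "two_degree_packing_number G = card R" by auto
  have "card R \<le> 2 * card T'"
    using T'(1) R(1) pack V
    by (intro card_packing_le_double_cover) (auto simp: vertex_cover_def intro: finite_subset)
  then have "\<lceil>real (two_degree_packing_number G) / 2\<rceil> \<le> int (covering_number G)"
    using T'(2) R(2) by (simp add: ceiling_le_iff)
  then show ?thesis using upper by simp
qed

end
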